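(* There is a constant $c$ such that the following holds. Suppose $p \ge 1$ and $n \ge p + c\log p$. Then in the $p$-processor cup game on $n$ cups, there exists an oblivious strategy for the filler and a step number $s \le \operatorname{poly}(p)$ such that, regardless of the (possibly randomized) strategy followed by the emptier, with constant probability the backlog after step $s$ is at least $\Omega(\log\log p)$.
   Context: The $p$-processor cup game on $n$ cups: $n$ cups with nonnegative real fills, initially all $0$. In each step, the filler first distributes up to $p$ units of water among the cups, placing at most $1$ unit into any single cup; then the emptier selects $p$ cups and removes up to $1$ unit of water from each. The backlog is the fill of the fullest cup. An oblivious filler strategy is a (possibly randomized) strategy whose placements do not depend on the emptier's actions or random choices. *)

theory Defs
  imports "HOL-Probability.Probability" "HOL-Computational_Algebra.Polynomial"
begin

text \<open>
  The cups are \<open>0, \<dots>, n - 1\<close>, and steps are counted from \<open>0\<close>: \<open>x t i\<close> is the amount of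
  water that the filler places into cup \<open>i\<close> in step \<open>t\<close>.  A deterministic emptier strategy maps
  the list of all placements made so far, including the one of the current step, to the
  amounts removed in the current step.  The earlier moves of the emptier need not be passed as
  arguments, because the strategy determines them from the earlier placements.
\<close>

type_synonym placements = "nat \<Rightarrow> nat \<Rightarrow> real"

type_synonym emptier = "(nat \<Rightarrow> real) list \<Rightarrow> nat \<Rightarrow> real"

definition legal_placements :: "nat \<Rightarrow> nat \<Rightarrow> placements \<Rightarrow> bool" where
  "legal_placements n p x \<longleftrightarrow>
     (\<forall>t. (\<forall>i<n. 0 \<le> x t i \<and> x t i \<le> 1) \<and> (\<forall>i\<ge>n. x t i = 0) \<and> (\<Sum>i<n. x t i) \<le> real p)"

text \<open>\<open>fill x e t i\<close> is the amount of water in cup \<open>i\<close> after \<open>t\<close> complete steps.\<close>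

primrec fill :: "placements \<Rightarrow> emptier \<Rightarrow> nat \<Rightarrow> nat \<Rightarrow> real" where
  "fill x e 0 = (\<lambda>i. 0)"
| "fill x e (Suc t) = (\<lambda>i. fill x e t i + x t i - e (map x [0..<Suc t]) i)"

text \<open>
  ``Removes up to 1 unit'' is read as: any amount between \<open>0\<close> and \<open>1\<close> that the cup contains.
\<close>

definition legal_emptier :: "nat \<Rightarrow> nat \<Rightarrow> emptier \<Rightarrow> bool" where
  "legal_emptier n p e \<longleftrightarrow>
     (\<forall>x t. legal_placements n p x \<longrightarrow>
        (\<exists>S \<subseteq> {..<n}. card S = p \<and>
           (\<forall>i\<in>S. 0 \<le> e (map x [0..<Suc t]) i \<and> e (map x [0..<Suc t]) i \<le> 1 \<and>
                   e (map x [0..<Suc t]) i \<le> fill x e t i + x t i) \<and>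
           (\<forall>i. i \<notin> S \<longrightarrow> e (map x [0..<Suc t]) i = 0)))"

definition backlog :: "nat \<Rightarrow> placements \<Rightarrow> emptier \<Rightarrow> nat \<Rightarrow> real" where
  "backlog n x e s = Max (fill x e s ` {..<n})"

text \<open>
  An oblivious filler draws its entire sequence of placements from a distribution fixed in advance.
\<close>

definition oblivious_filler :: "nat \<Rightarrow> nat \<Rightarrow> placements pmf \<Rightarrow> bool" where
  "oblivious_filler n p F \<longleftrightarrow> (\<forall>x\<in>set_pmf F. legal_placements n p x)"

text \<open>
  A randomized emptier is a random deterministic strategy.  Its distribution need not be
  discrete; only the removal made after each fixed history has to be a random variable.
\<close>

definition randomized_emptier :: "nat \<Rightarrow> nat \<Rightarrow> emptier measure \<Rightarrow> bool" where
  "randomized_emptier n p E \<longleftrightarrow>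
     prob_space E \<and> (\<forall>e\<in>space E. legal_emptier n p e) \<and>
     (\<forall>h i. (\<lambda>e. e h i) \<in> borel_measurable E)"

text \<open>
  The joint law of the two players, whose random choices are independent.  Restricting \<open>F\<close> to
  its countable support makes every event measurable that is measurable in the emptier's
  strategy for each fixed placement sequence; on the uncountable type of all placement
  sequences, with every set measurable, this would fail.
\<close>

definition joint_law :: "placements pmf \<Rightarrow> emptier measure \<Rightarrow> (placements \<times> emptier) measure" where
  "joint_law F E = restrict_space (measure_pmf F) (set_pmf F) \<Otimes>\<^sub>M E"

lemma prob_space_joint_law:
  assumes "randomized_emptier n p E"
  shows "prob_space (joint_law F E)"
proof -
  interpret E: prob_space E using assms by (simp add: randomized_emptier_def)
  interpret F: prob_space "restrict_space (measure_pmf F) (set_pmf F)"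
    by (rule prob_space_restrict_space) (simp_all add: emeasure_pmf)
  interpret pair_prob_space "restrict_space (measure_pmf F) (set_pmf F)" E ..
  show ?thesis unfolding joint_law_def by (rule prob_space_axioms)
qed

lemma measurable_fill:
  assumes "randomized_emptier n p E"
  shows "(\<lambda>e. fill x e s i) \<in> borel_measurable E"
proof (induction s)
  case (Suc s)
  have "(\<lambda>e. e (map x [0..<Suc s]) i) \<in> borel_measurable E"
    using assms unfolding randomized_emptier_def by blast
  with Suc show ?case
    by (simp only: fill.simps) (intro borel_measurable_diff borel_measurable_add, auto)
qed simp

lemma measurable_backlog:
  assumes "randomized_emptier n p E"
  shows "(\<lambda>(x, e). backlog n x e s) \<in> borel_measurable (joint_law F E)"
proof -
  have sec: "(\<lambda>e. backlog n x e s) \<in> borel_measurable E" for x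
    unfolding backlog_def
    by (rule borel_measurable_Max) (auto intro: measurable_fill[OF assms])
  have "sets (restrict_space (measure_pmf F) (set_pmf F)) = sets (count_space (set_pmf F))"
    by (auto simp: sets_restrict_space)
  then have "sets (joint_law F E) = sets (count_space (set_pmf F) \<Otimes>\<^sub>M E)"
    unfolding joint_law_def by (rule sets_pair_measure_cong) simp
  moreover have "(\<lambda>(x, e). backlog n x e s) \<in> borel_measurable (count_space (set_pmf F) \<Otimes>\<^sub>M E)"
    by (rule measurable_pair_measure_countable1) (auto intro: sec countable_set_pmf)
  ultimately show ?thesis
    using measurable_cong_sets by blast
qed

end

theory Submission
  imports Defs "HOL-Analysis.Harmonic_Numbers"
begin

text \<open>
  At any time \<open>p - 1\<close> of the cups are anchors, which receive one unit in every step, so that their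
  fills never decrease.  Whenever the emptier does not select all the anchors, their total fill
  grows by at least one; otherwise it touches at most one other cup.  On \<open>k\<close> further cups, where
  \<open>fact k\<close> is small compared to \<open>p\<close>, the filler plays rounds of the one-processor game: it spreads
  one unit evenly over the active cups and then deactivates a random one of them.  With
  probability \<open>1 / fact k\<close> it always deactivates the cup that has just been touched, and then the last
  cup has fill at least \<open>harm k - 1\<close>.  At the end of each round, with a small probability, the
  filler promotes the last cup to an anchor in place of a random old one, which preserves its fill.

  Either the emptier serves the anchors in most of the rounds, and a full cup is eventually
  promoted, or it skips anchors so often that they fill up themselves.  The number of promotions
  is expected to be a small fraction of \<open>p\<close>, so a full anchor stays one with constant probability.
  This is made precise by a lower bound for the value of the game that is linear in the total
  fill of the anchors and in the number of remaining rounds.  Choosing \<open>k\<close> of order between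
  \<open>sqrt (log p)\<close> and its half gives \<open>harm k\<close> of order \<open>log (log p)\<close>.
\<close>

subsection \<open>The value of the game against a Markovian filler\<close>

lemma fill_cong:
  assumes "\<And>u. u < t \<Longrightarrow> x u = y u"
  shows "fill x e t = fill y e t"
  using assms
proof (induction t)
  case (Suc t)
  have "map x [0..<Suc t] = map y [0..<Suc t]" using Suc.prems by (intro map_cong) auto
  moreover have "fill x e t = fill y e t" "x t = y t" using Suc by auto
  ultimately show ?case by (simp only: fill.simps)
qed simp

lemma prob_bind_pmf:
  "measure_pmf.prob (bind_pmf M f) A = measure_pmf.expectation M (\<lambda>x. measure_pmf.prob (f x) A)"
proof -
  have "ennreal (measure_pmf.prob (bind_pmf M f) A) =
      (\<integral>\<^sup>+ x. ennreal (measure_pmf.prob (f x) A) \<partial>measure_pmf M)"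
    by (simp flip: measure_pmf.emeasure_eq_measure)
  also have "\<dots> = ennreal (measure_pmf.expectation M (\<lambda>x. measure_pmf.prob (f x) A))"
    by (intro nn_integral_eq_integral measure_pmf.integrable_const_bound[where B = 1]) auto
  finally show ?thesis
    by (subst (asm) ennreal_inj) (auto intro: Bochner_Integration.integral_nonneg)
qed

text \<open>A move is encoded by the resulting fills \<open>h\<close> instead of the removed
  amounts; \<open>g\<close> is the fill after the placement of the current step.\<close>

definition moves :: "nat \<Rightarrow> nat \<Rightarrow> (nat \<Rightarrow> real) \<Rightarrow> (nat \<Rightarrow> real) set" where
  "moves n p g = {h. \<exists>S\<subseteq>{..<n}. card S = p \<and>
     (\<forall>i\<in>S. g i - 1 \<le> h i \<and> 0 \<le> h i \<and> h i \<le> g i) \<and> (\<forall>i. i \<notin> S \<longrightarrow> h i = g i)}"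

lemma fill_Suc_in_moves:
  assumes "legal_emptier n p e" "legal_placements n p x"
  shows "fill x e (Suc t) \<in> moves n p (\<lambda>i. fill x e t i + x t i)"
proof -
  obtain S where "S \<subseteq> {..<n}" "card S = p"
    "\<forall>i\<in>S. 0 \<le> e (map x [0..<Suc t]) i \<and> e (map x [0..<Suc t]) i \<le> 1 \<and>
       e (map x [0..<Suc t]) i \<le> fill x e t i + x t i"
    "\<forall>i. i \<notin> S \<longrightarrow> e (map x [0..<Suc t]) i = 0"
    using assms unfolding legal_emptier_def by blast
  then show ?thesis
    unfolding moves_def by (auto simp del: upt_Suc simp: fun_eq_iff intro!: exI[of _ S])
qed

text \<open>By Fubini: a bound that holds for every deterministic emptier survives averaging over
  \<open>E\<close>, so randomness does not help the emptier.\<close>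

lemma joint_law_prob_ge:
  assumes E: "randomized_emptier n p E"
    and F: "\<And>e. legal_emptier n p e \<Longrightarrow> \<delta> \<le> measure_pmf.prob F {x. b \<le> backlog n x e s}"
  shows "\<delta> \<le> \<P>((x, e) in joint_law F E. b \<le> backlog n x e s)"
proof -
  let ?M = "restrict_space (measure_pmf F) (set_pmf F)"
  interpret E: prob_space E using E by (simp add: randomized_emptier_def)
  interpret F: prob_space ?M
    by (rule prob_space_restrict_space) (simp_all add: emeasure_pmf)
  interpret FE: pair_prob_space ?M E ..
  interpret J: prob_space "joint_law F E" by (rule prob_space_joint_law[OF E])
  let ?X = "{\<omega> \<in> space (joint_law F E). b \<le> (case \<omega> of (x, e) \<Rightarrow> backlog n x e s)}"
  have meas: "?X \<in> sets (joint_law F E)"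
    using measurable_backlog[OF E, where F = F and s = s] by measurable
  have "ennreal \<delta> \<le> emeasure ?M ((\<lambda>x. (x, e)) -` ?X)" if e: "e \<in> space E" for e
  proof -
    have "(\<lambda>x. (x, e)) -` ?X = {x. b \<le> backlog n x e s} \<inter> set_pmf F"
      using e by (auto simp: joint_law_def space_pair_measure space_restrict_space)
    then have "emeasure ?M ((\<lambda>x. (x, e)) -` ?X) =
        emeasure (measure_pmf F) ({x. b \<le> backlog n x e s} \<inter> set_pmf F)"
      by (simp add: emeasure_restrict_space)
    also have "\<dots> = ennreal (measure_pmf.prob F {x. b \<le> backlog n x e s})"
      by (simp add: measure_pmf.emeasure_eq_measure measure_Int_set_pmf)
    finally show ?thesis
      using F[of e] E e by (auto simp: randomized_emptier_def intro: ennreal_leI)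
  qed
  then have "(\<integral>\<^sup>+ e. ennreal \<delta> \<partial>E) \<le> (\<integral>\<^sup>+ e. emeasure ?M ((\<lambda>x. (x, e)) -` ?X) \<partial>E)"
    by (rule nn_integral_mono)
  then have "ennreal \<delta> \<le> emeasure (joint_law F E) ?X"
    using meas unfolding joint_law_def
    by (simp add: E.emeasure_space_1 FE.emeasure_pair_measure_alt2)
  then have "\<delta> \<le> measure (joint_law F E) ?X"
    by (simp add: J.emeasure_eq_measure)
  then show ?thesis by (simp add: case_prod_unfold)
qed

text \<open>The state evolves by \<open>K\<close> alone, without access to the fills; this makes the
  filler oblivious.\<close>

locale markov_filler =
  fixes n p :: nat and B :: real
    and place :: "'s \<Rightarrow> nat \<Rightarrow> real" and K :: "'s \<Rightarrow> 's pmf" and St :: "'s set"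
  assumes K_St: "\<And>s. s \<in> St \<Longrightarrow> set_pmf (K s) \<subseteq> St"
    and finite_K: "\<And>s. s \<in> St \<Longrightarrow> finite (set_pmf (K s))"
    and place_bounds: "\<And>s i. s \<in> St \<Longrightarrow> 0 \<le> place s i \<and> place s i \<le> 1"
    and place_outside: "\<And>s i. s \<in> St \<Longrightarrow> n \<le> i \<Longrightarrow> place s i = 0"
    and place_sum: "\<And>s. s \<in> St \<Longrightarrow> (\<Sum>i<n. place s i) \<le> real p"
begin

text \<open>
  The value of the game with \<open>t\<close> steps to go, the filler aiming for a cup of fill at least \<open>B\<close>.
  The emptier moves knowing the current state but not the next one.  Inserting \<open>1\<close> keeps the
  infimum meaningful when no move is legal.
\<close>

primrec val :: "nat \<Rightarrow> 's \<Rightarrow> (nat \<Rightarrow> real) \<Rightarrow> real" where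
  "val 0 s f = (if \<exists>i<n. B \<le> f i then 1 else 0)"
| "val (Suc t) s f = Inf (insert 1
     ((\<lambda>f'. measure_pmf.expectation (K s) (\<lambda>s'. val t s' f')) ` moves n p (\<lambda>i. f i + place s i)))"

primrec traj :: "nat \<Rightarrow> 's \<Rightarrow> 's list pmf" where
  "traj 0 s = return_pmf []"
| "traj (Suc t) s = map_pmf ((#) s) (bind_pmf (K s) (traj t))"

text \<open>Padding with zeros turns a finite trajectory into a complete placement sequence.\<close>

definition placements_of :: "'s list \<Rightarrow> placements" where
  "placements_of l t = (if t < length l then place (l ! t) else (\<lambda>_. 0))"

lemma val_nonneg: "0 \<le> val t s f"
proof (cases t)
  case (Suc t')
  have "0 \<le> val t' s f" for s f
  proof (induction t' arbitrary: s f)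
    case (Suc t)
    then show ?case by (auto intro!: cInf_greatest Bochner_Integration.integral_nonneg)
  qed simp
  then show ?thesis unfolding Suc by (auto intro!: cInf_greatest Bochner_Integration.integral_nonneg)
qed simp

lemma val_Suc_le:
  assumes "f' \<in> moves n p (\<lambda>i. f i + place s i)"
  shows "val (Suc t) s f \<le> measure_pmf.expectation (K s) (\<lambda>s'. val t s' f')"
proof -
  have "bdd_below (insert 1
      ((\<lambda>f'. measure_pmf.expectation (K s) (\<lambda>s'. val t s' f')) ` moves n p (\<lambda>i. f i + place s i)))"
    by (rule bdd_belowI[of _ 0]) (auto intro!: Bochner_Integration.integral_nonneg val_nonneg)
  then show ?thesis
    unfolding val.simps using assms by (intro cInf_lower) auto
qed

lemma le_val_Suc:
  assumes "c \<le> 1"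
    "\<And>f'. f' \<in> moves n p (\<lambda>i. f i + place s i) \<Longrightarrow>
       c \<le> measure_pmf.expectation (K s) (\<lambda>s'. val t s' f')"
  shows "c \<le> val (Suc t) s f"
  unfolding val.simps using assms by (intro cInf_greatest) auto

lemma set_traj: "s \<in> St \<Longrightarrow> l \<in> set_pmf (traj t s) \<Longrightarrow> length l = t \<and> set l \<subseteq> St"
proof (induction t arbitrary: s l)
  case (Suc t)
  then show ?case using K_St by fastforce
qed simp

lemma legal_placements_of: "set l \<subseteq> St \<Longrightarrow> legal_placements n p (placements_of l)"
  unfolding legal_placements_def placements_of_def
  using place_bounds place_outside place_sum by (auto simp: subset_iff)

text \<open>Given the history, the answer of the emptier to a placement is one element of
  \<open>moves\<close>, fixed before the next state is drawn. Hence the infimum in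
  \<open>val\<close> bounds it from below, and averaging over \<open>K s\<close> matches the
  recursion of \<open>traj\<close>.\<close>

lemma val_le_prob:
  assumes "legal_emptier n p e" "set l \<subseteq> St" "s \<in> St"
  shows "val t s (fill (placements_of l) e (length l)) \<le> measure_pmf.prob (traj t s)
    {l'. \<exists>i<n. B \<le> fill (placements_of (l @ l')) e (length l + t) i}"
  using assms(2,3)
proof (induction t arbitrary: s l)
  case 0
  then show ?case by (simp add: indicator_def)
next
  case (Suc t)
  define l1 where "l1 = l @ [s]"
  have l1: "set l1 \<subseteq> St" using Suc.prems by (simp add: l1_def)
  let ?x = "placements_of l1"
  have "fill ?x e (length l) = fill (placements_of l) e (length l)"
    by (rule fill_cong) (auto simp: placements_of_def l1_def nth_append)
  then have mv: "fill ?x e (length l1) \<in>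
      moves n p (\<lambda>i. fill (placements_of l) e (length l) i + place s i)"
    using fill_Suc_in_moves[OF assms(1) legal_placements_of[OF l1], of "length l"]
    by (simp add: l1_def placements_of_def)
  let ?W = "{l'. \<exists>i<n. B \<le> fill (placements_of (l1 @ l')) e (length l1 + t) i}"
  have "val (Suc t) s (fill (placements_of l) e (length l)) \<le>
      measure_pmf.expectation (K s) (\<lambda>s'. val t s' (fill ?x e (length l1)))"
    by (rule val_Suc_le[OF mv])
  also have "\<dots> \<le> measure_pmf.expectation (K s) (\<lambda>s'. measure_pmf.prob (traj t s') ?W)"
    using Suc.IH[OF l1] K_St[OF Suc.prems(2)] Suc.prems(2)
    by (intro integral_mono_AE integrable_measure_pmf_finite finite_K)
      (auto simp: AE_measure_pmf_iff)
  also have "\<dots> = measure_pmf.prob (traj (Suc t) s)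
      {l'. \<exists>i<n. B \<le> fill (placements_of (l @ l')) e (length l + Suc t) i}"
    by (simp add: prob_bind_pmf vimage_def l1_def)
  finally show ?case .
qed

end

subsection \<open>Anchors and rounds\<close>

locale anchored_rounds =
  fixes n p k :: nat and B :: real
  assumes k_pos: "1 \<le> k" and n_ge: "p - 1 + k \<le> n" and p_ge: "8 * fact k \<le> p - 1"
    and B_nonneg: "0 \<le> B" and B_le: "B \<le> harm k - 1"
begin

text \<open>
  In a state \<open>(Q, A)\<close>, \<open>Q\<close> is the set of anchors and \<open>A\<close> the set of the cups that are still
  active in the current round.  Each round ends with a promotion with probability \<open>1 / M\<close>.
\<close>

definition cups :: "nat set" where "cups = {..<p - 1 + k}"

text \<open>Promotions are so rare that the expected loss \<open>\<kappa>\<close> from swapping out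
  an anchor is at most half of the bonus \<open>\<alpha> / fact k\<close>; see
  \<open>round_gain\<close>.\<close>

definition M :: nat where "M = 2 * p * k"

definition states :: "(nat set \<times> nat set) set" where
  "states = {(Q, A). Q \<subseteq> cups \<and> card Q = p - 1 \<and> A \<subseteq> cups - Q \<and> A \<noteq> {}}"

definition place :: "nat set \<times> nat set \<Rightarrow> nat \<Rightarrow> real" where
  "place s i = (if i \<in> fst s then 1 else if i \<in> snd s then 1 / real (card (snd s)) else 0)"

definition new_round :: "nat set \<Rightarrow> nat set \<times> nat set" where
  "new_round Q = (Q, cups - Q)"

text \<open>The event \<open>u = 0\<close> is the coin of probability \<open>1 / M\<close>, and
  \<open>j\<close> is the anchor to be replaced; one product set keeps the transition
  uniform.\<close>

definition kernel :: "nat set \<times> nat set \<Rightarrow> (nat set \<times> nat set) pmf" where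
  "kernel s = (case s of (Q, A) \<Rightarrow>
     if card A = 1
     then map_pmf (\<lambda>(u, j). new_round (if u = 0 then insert (the_elem A) (Q - {j}) else Q))
            (pmf_of_set ({..<M} \<times> Q))
     else map_pmf (\<lambda>x. (Q, A - {x})) (pmf_of_set A))"

section \<open>States, transitions and legality of the filler\<close>

lemma p_ge2: "2 \<le> p"
  using p_ge fact_ge_1[of k, where 'a = nat] by linarith

lemma M_ge: "4 \<le> M"
  using mult_le_mono[OF p_ge2 k_pos] unfolding M_def by linarith

lemma finite_cups [simp]: "finite cups" and card_cups: "card cups = p - 1 + k"
  by (simp_all add: cups_def)

lemma statesD:
  assumes "(Q, A) \<in> states"
  shows "Q \<subseteq> cups" "card Q = p - 1" "finite Q" "Q \<noteq> {}" "A \<subseteq> cups - Q" "finite A" "A \<noteq> {}"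
    "1 \<le> card A"
proof -
  show *: "Q \<subseteq> cups" "card Q = p - 1" "A \<subseteq> cups - Q" "A \<noteq> {}"
    using assms by (auto simp: states_def)
  then show "finite Q" "finite A" using finite_cups by (auto intro: finite_subset)
  then show "Q \<noteq> {}" "1 \<le> card A" using * p_ge2 by (auto simp: Suc_le_eq card_gt_0_iff)
qed

lemma card_pool:
  assumes "Q \<subseteq> cups" "card Q = p - 1"
  shows "card (cups - Q) = k"
  using assms by (simp add: card_Diff_subset card_cups finite_subset[OF _ finite_cups])

lemma new_round_states:
  assumes "Q \<subseteq> cups" "card Q = p - 1"
  shows "new_round Q \<in> states"
  using assms card_pool[OF assms] k_pos by (auto simp: states_def new_round_def)

lemma swap_anchor:
  assumes "(Q, {x}) \<in> states" "j \<in> Q"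
  shows "insert x (Q - {j}) \<subseteq> cups" "card (insert x (Q - {j})) = p - 1"
  using statesD[OF assms(1)] assms(2) p_ge2 by auto

lemma kernel_promote:
  "kernel (Q, {x}) = map_pmf (\<lambda>(u, j). new_round (if u = 0 then insert x (Q - {j}) else Q))
     (pmf_of_set ({..<M} \<times> Q))"
  by (simp add: kernel_def cong: if_cong)

lemma expectation_kernel_drop:
  assumes "(Q, A) \<in> states" "card A \<noteq> 1"
  shows "measure_pmf.expectation (kernel (Q, A)) v = (\<Sum>x\<in>A. v (Q, A - {x})) / real (card A)"
  using statesD[OF assms(1)] assms(2) by (simp add: kernel_def integral_pmf_of_set)

lemma expectation_kernel_promote:
  assumes "(Q, {x}) \<in> states"
  shows "measure_pmf.expectation (kernel (Q, {x})) v =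
    (1 - 1 / real M) * v (new_round Q) +
    (\<Sum>j\<in>Q. v (new_round (insert x (Q - {j})))) / (real M * real (p - 1))"
proof -
  note st = statesD[OF assms]
  let ?g = "\<lambda>u j. v (new_round (if u = (0::nat) then insert x (Q - {j}) else Q))"
  have M: "{..<M} = insert 0 {1..<M}" "M \<noteq> 0" using M_ge by auto
  have "(\<Sum>(u, j)\<in>{..<M} \<times> Q. ?g u j) = (\<Sum>u<M. \<Sum>j\<in>Q. ?g u j)"
    by (simp add: sum.cartesian_product)
  also have "\<dots> = (\<Sum>j\<in>Q. ?g 0 j) + (\<Sum>u=1..<M. \<Sum>j\<in>Q. ?g u j)"
    unfolding M(1) by (subst sum.insert) auto
  also have "(\<Sum>u=1..<M. \<Sum>j\<in>Q. ?g u j) = (\<Sum>u=1..<M. real (p - 1) * v (new_round Q))"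
    by (rule sum.cong) (auto simp: st)
  also have "\<dots> = (real M - 1) * real (p - 1) * v (new_round Q)"
    using M_ge by (simp add: of_nat_diff)
  finally have "(\<Sum>(u, j)\<in>{..<M} \<times> Q. ?g u j) =
      (\<Sum>j\<in>Q. ?g 0 j) + (real M - 1) * real (p - 1) * v (new_round Q)" .
  moreover have "measure_pmf.expectation (kernel (Q, {x})) v =
      (\<Sum>(u, j)\<in>{..<M} \<times> Q. ?g u j) / (real M * real (p - 1))"
    using st M(2) by (simp add: kernel_promote integral_pmf_of_set case_prod_unfold card_cartesian_product lessThan_empty_iff)
  moreover have "real (p - 1) \<noteq> 0" "real M \<noteq> 0" using p_ge2 M_ge by auto
  moreover have "(S + (m - 1) * q * w) / (m * q) = (1 - 1 / m) * w + S / (m * q)"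
    if "m \<noteq> 0" "q \<noteq> 0" for S m q w :: real
    using that by (simp add: field_simps)
  ultimately show ?thesis by (simp only: if_True simp_thms)
qed

sublocale markov_filler n p B place kernel states
proof
  fix s assume "s \<in> states"
  then obtain Q A where s: "s = (Q, A)" "(Q, A) \<in> states" by (cases s) auto
  note st = statesD[OF s(2)]
  have M: "{..<M} \<times> Q \<noteq> {}" using M_ge st by (auto simp: lessThan_empty_iff)
  show "finite (set_pmf (kernel s))"
    using st M by (simp add: s kernel_def)
  show "set_pmf (kernel s) \<subseteq> states"
  proof (cases "card A = 1")
    case True
    then obtain x where x: "A = {x}" by (auto simp: card_1_singleton_iff)
    show ?thesis
      using M new_round_states[OF st(1,2)] new_round_states[OF swap_anchor[of Q x]] s(2) st(3)
      by (auto simp: s kernel_promote x split: if_split_asm)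
  next
    case False
    have "A - {x} \<noteq> {}" if "x \<in> A" for x
      using False that by (auto simp: card_1_singleton_iff)
    then show ?thesis using st False by (auto simp: s kernel_def states_def)
  qed
  show "0 \<le> place s i \<and> place s i \<le> 1" for i
    using st(8) by (auto simp: s place_def divide_le_eq_1)
  show "place s i = 0" if "n \<le> i" for i
    using that st n_ge by (auto simp: s place_def cups_def)
  have "(\<Sum>i<n. place s i) = (\<Sum>i\<in>Q \<union> A. place s i)"
    using st n_ge by (intro sum.mono_neutral_right) (auto simp: s place_def cups_def)
  also have "\<dots> = (\<Sum>i\<in>Q. place s i) + (\<Sum>i\<in>A. place s i)"
    using st by (intro sum.union_disjoint) auto
  also have "(\<Sum>i\<in>A. place s i) = (\<Sum>i\<in>A. 1 / real (card A))"
    using st by (intro sum.cong) (auto simp: s place_def)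
  also have "(\<Sum>i\<in>Q. place s i) = real (p - 1)"
    using st by (simp add: s place_def)
  also have "(\<Sum>i\<in>A. 1 / real (card A)) = 1" using st by simp
  finally show "(\<Sum>i<n. place s i) \<le> real p" using p_ge2 by simp
qed

text \<open>Anchors and a last active cup receive a full unit, so they cannot lose fill. If all
  \<open>p - 1\<close> anchors are selected, only one selection is left for the other cups;
  otherwise a skipped anchor gains a whole unit.\<close>

lemma moves_bounds:
  assumes st: "(Q, A) \<in> states" and f: "\<And>i. 0 \<le> f i"
    and h: "h \<in> moves n p (\<lambda>i. f i + place (Q, A) i)"
  shows "0 \<le> h i" "i \<in> Q \<Longrightarrow> f i \<le> h i \<and> h i \<le> f i + 1" "A = {x} \<Longrightarrow> f x \<le> h x"
    "sum f Q + 1 \<le> sum h Q \<or> (\<exists>z\<in>A. \<forall>i\<in>A - {z}. h i = f i + 1 / real (card A))"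
proof -
  note st' = statesD[OF st]
  obtain S where S: "S \<subseteq> {..<n}" "card S = p"
    "\<And>i. i \<in> S \<Longrightarrow> f i + place (Q, A) i - 1 \<le> h i \<and> 0 \<le> h i \<and> h i \<le> f i + place (Q, A) i"
    "\<And>i. i \<notin> S \<Longrightarrow> h i = f i + place (Q, A) i"
    using h unfolding moves_def by blast
  have pl: "0 \<le> place (Q, A) i" for i using place_bounds[OF st] by blast
  show "0 \<le> h i" for i using S(3,4)[of i] f[of i] pl[of i] by (cases "i \<in> S") auto
  show Q: "f i \<le> h i \<and> h i \<le> f i + 1" if "i \<in> Q" for i
    using S(3,4)[of i] that by (cases "i \<in> S") (auto simp: place_def)
  show "f x \<le> h x" if "A = {x}"
    using S(3,4)[of x] that by (cases "x \<in> S") (auto simp: place_def split: if_splits)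
  show "sum f Q + 1 \<le> sum h Q \<or> (\<exists>z\<in>A. \<forall>i\<in>A - {z}. h i = f i + 1 / real (card A))"
  proof (cases "Q \<subseteq> S")
    case True
    have "card (S - Q) = 1" using True S(2) st' p_ge2 by (simp add: card_Diff_subset)
    then obtain y where y: "S - Q = {y}" by (auto simp: card_1_singleton_iff)
    \<comment> \<open>If the spare selection falls outside \<open>A\<close>, no active cup is
      touched and any \<open>z\<close> serves.\<close>
    define z where "z = (if y \<in> A then y else (SOME z. z \<in> A))"
    have z: "z \<in> A" using st'(7) by (auto simp: z_def some_in_eq)
    have "h i = f i + 1 / real (card A)" if "i \<in> A - {z}" for i
    proof -
      have "i \<notin> Q" using that st' by auto
      moreover have "i \<notin> S" using that \<open>i \<notin> Q\<close> y by (auto simp: z_def split: if_splits)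
      ultimately show ?thesis using S(4)[of i] that by (simp add: place_def)
    qed
    then show ?thesis using z by blast
  next
    case False
    then obtain j where j: "j \<in> Q" "j \<notin> S" by blast
    have "sum f Q + 1 = (f j + 1) + sum f (Q - {j})" using j st' by (simp add: sum.remove)
    also have "\<dots> \<le> h j + sum h (Q - {j})"
      using S(4)[OF j(2)] j Q by (intro add_mono sum_mono) (auto simp: place_def)
    also have "\<dots> = sum h Q" using j st' by (simp add: sum.remove)
    finally show ?thesis ..
  qed
qed

text \<open>A full anchor stays full, and it is replaced at the end of a round with probability
  \<open>1 / (M * (p - 1))\<close>. The bound sums this over the current round and the
  \<open>r\<close> later ones.\<close>

lemma val_full_anchor:
  assumes "(Q, A) \<in> states" "\<And>i. 0 \<le> f i" "i \<in> Q" "B \<le> f i" "t = k * r + card A"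
  shows "1 - (real r + 1) / (real M * real (p - 1)) \<le> val t (Q, A) f"
  using assms(1,2,4,5) \<open>i \<in> Q\<close>
proof (induction t arbitrary: Q A f r)
  case 0
  then show ?case using statesD(8)[OF 0(1)] by simp
next
  case (Suc t)
  note st = statesD[OF Suc.prems(1)]
  define \<eta> where "\<eta> = 1 / (real M * real (p - 1))"
  have \<eta>: "0 \<le> \<eta>" by (simp add: \<eta>_def)
  have "1 - (real r + 1) * \<eta> \<le> val (Suc t) (Q, A) f"
  proof (rule le_val_Suc)
    show "1 - (real r + 1) * \<eta> \<le> 1" using \<eta> by simp
    fix h assume h: "h \<in> moves n p (\<lambda>i. f i + place (Q, A) i)"
    note mv = moves_bounds[OF Suc.prems(1,2) h]
    have hi: "B \<le> h i" using mv(2)[OF \<open>i \<in> Q\<close>] Suc.prems(3) by simp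
    show "1 - (real r + 1) * \<eta> \<le> measure_pmf.expectation (kernel (Q, A)) (\<lambda>s'. val t s' h)"
    proof (cases "card A = 1")
      case False
      have "1 - (real r + 1) * \<eta> \<le> val t (Q, A - {x}) h" if "x \<in> A" for x
      proof -
        have "(Q, A - {x}) \<in> states"
          using Suc.prems(1) False that by (auto simp: states_def card_1_singleton_iff)
        moreover have "t = k * r + card (A - {x})"
          using Suc.prems(4) that st by simp
        ultimately show ?thesis
          using Suc.IH[of Q "A - {x}" h r] mv(1) hi Suc.prems(5) by (simp add: \<eta>_def)
      qed
      then have "real (card A) * (1 - (real r + 1) * \<eta>) \<le> (\<Sum>x\<in>A. val t (Q, A - {x}) h)"
        by (intro sum_bounded_below)
      then show ?thesis
        using st(8) by (simp add: expectation_kernel_drop[OF Suc.prems(1) False] field_simps)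
    next
      case True
      then obtain x where x: "A = {x}" by (auto simp: card_1_singleton_iff)
      have t: "t = k * r" using Suc.prems(4) True by simp
      have nxt: "1 - real r * \<eta> \<le> val t (new_round Q') h"
        if Q': "Q' \<subseteq> cups" "card Q' = p - 1" "i \<in> Q'" for Q'
      proof (cases r)
        case 0
        have "i < n" using Q' n_ge by (auto simp: cups_def)
        then show ?thesis using hi 0 t by auto
      next
        case (Suc r')
        have "t = k * r' + card (cups - Q')" using t Suc card_pool[OF Q'(1,2)] by simp
        then show ?thesis
          using Suc.IH[of Q' "cups - Q'" h r'] new_round_states[OF Q'(1,2)] mv(1) hi Q'(3) Suc
          by (simp add: new_round_def \<eta>_def add.commute)
      qed
      let ?c = "1 - real r * \<eta>"
      have "real (p - 2) * ?c = (\<Sum>j\<in>Q - {i}. ?c)"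
        using st Suc.prems(5) p_ge2 by (simp add: numeral_2_eq_2)
      also have "\<dots> \<le> (\<Sum>j\<in>Q - {i}. val t (new_round (insert x (Q - {j}))) h)"
        using swap_anchor[of Q x] Suc.prems(1,5) x by (intro sum_mono nxt) auto
      \<comment> \<open>The outcome \<open>j = i\<close>, where the full anchor is replaced, is
        counted as a loss.\<close>
      also have "\<dots> \<le> (\<Sum>j\<in>Q. val t (new_round (insert x (Q - {j}))) h)"
        using st by (intro sum_mono2 val_nonneg) auto
      finally have "\<eta> * (real (p - 2) * ?c) \<le> \<eta> * (\<Sum>j\<in>Q. val t (new_round (insert x (Q - {j}))) h)"
        using \<eta> by (rule mult_left_mono)
      moreover have "(1 - 1 / real M) * ?c \<le> (1 - 1 / real M) * val t (new_round Q) h"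
        using nxt[OF st(1,2) Suc.prems(5)] M_ge by (intro mult_left_mono) auto
      moreover have "(1 - 1 / real M) * ?c + \<eta> * (real (p - 2) * ?c) = ?c - \<eta> + real r * \<eta>\<^sup>2"
      proof -
        have "1 / real M = \<eta> * (real (p - 2) + 1)"
          using p_ge2 M_ge by (simp add: \<eta>_def field_simps of_nat_diff)
        then show ?thesis by (simp only:) (simp add: algebra_simps power2_eq_square)
      qed
      moreover have "0 \<le> real r * \<eta>\<^sup>2" by simp
      moreover have "1 - (real r + 1) * \<eta> = ?c - \<eta>" by (simp add: algebra_simps)
      ultimately have "1 - (real r + 1) * \<eta> \<le> (1 - 1 / real M) * val t (new_round Q) h
          + \<eta> * (\<Sum>j\<in>Q. val t (new_round (insert x (Q - {j}))) h)"
        by linarith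
      then show ?thesis
        using expectation_kernel_promote[of Q x] Suc.prems(1) x by (simp add: \<eta>_def)
    qed
  qed
  then show ?case by (simp add: \<eta>_def)
qed


text \<open>
  \<open>\<phi> r w\<close> bounds the value from below when \<open>r\<close> rounds are to be played and the anchors hold \<open>w\<close>
  units, none of them \<open>B\<close> or more.  A skipped anchor is worth at least \<open>\<alpha>\<close> to the filler; \<open>\<kappa>\<close>
  bounds the expected loss of \<open>\<phi>\<close> when a random anchor is swapped out at the end of a round; the bonus
  \<open>\<alpha> / fact a\<close> accounts for the chance \<open>1 / fact a\<close> of guessing the remaining moves of the
  emptier when \<open>a\<close> cups are active and all of them still hold the water of the round.
\<close>

definition \<alpha> :: real where "\<alpha> = 1 / (4 * real M)"

definition \<phi> :: "nat \<Rightarrow> real \<Rightarrow> real" where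
  "\<phi> r w = \<alpha> * (w - real p * B) + real r / (8 * real M * fact k)"

definition \<kappa> :: real where "\<kappa> = \<alpha> * (B + 1) / real M"

text \<open>Long enough for the round term of \<open>\<phi>\<close> to reach 1/4, which outweighs
  the initial deficit of at most 1/8, yet the expected number of promotions is only
  \<open>2 * fact k\<close>.\<close>

definition rounds :: nat where "rounds = 2 * fact k * M"

text \<open>A cup untouched since the start of the round has received
  \<open>1 / k + ... + 1 / (card A + 1)\<close>, which is this difference of harmonic
  numbers.\<close>

definition fresh :: "nat set \<Rightarrow> (nat \<Rightarrow> real) \<Rightarrow> bool" where
  "fresh A f \<longleftrightarrow> (\<forall>i\<in>A. harm k - harm (card A) \<le> f i)"

definition bonus :: "nat set \<Rightarrow> (nat \<Rightarrow> real) \<Rightarrow> real" where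
  "bonus A f = (if fresh A f then \<alpha> / fact (card A) else 0)"

section \<open>Arithmetic of the linear bound\<close>

lemma B_less: "B + 1 \<le> real k"
proof -
  have "harm m \<le> real m" for m
  proof (induction m)
    case (Suc m)
    have "inverse (real (Suc m)) \<le> 1" by (simp add: inverse_le_1_iff)
    with Suc show ?case by (simp add: harm_Suc)
  qed (simp add: harm_expand)
  then show ?thesis using B_le by (meson add_le_imp_le_diff diff_le_eq le_diff_eq order_trans)
qed

lemma \<alpha>_pos: "0 < \<alpha>" and \<alpha>_le: "\<alpha> \<le> 1 / 16"
  using M_ge by (auto simp: \<alpha>_def field_simps)

lemma \<alpha>_p: "\<alpha> * (real p * real k) = 1 / 8"
  using p_ge2 k_pos by (simp add: \<alpha>_def M_def)

lemma \<kappa>_nonneg: "0 \<le> \<kappa>"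
  using \<alpha>_pos B_nonneg by (simp add: \<kappa>_def)

lemma bonus_bounds: "0 \<le> bonus A f" "bonus A f \<le> \<alpha>"
  using \<alpha>_pos by (auto simp: bonus_def divide_le_eq mult_le_cancel_left1)

lemma \<phi>_mono: "w \<le> w' \<Longrightarrow> \<phi> r w \<le> \<phi> r w'"
  using \<alpha>_pos by (simp add: \<phi>_def)

lemma \<phi>_add: "\<phi> r (w + d) = \<phi> r w + \<alpha> * d"
  by (simp add: \<phi>_def algebra_simps)

text \<open>This leaves room below the cap 3/4 in \<open>val_ge\<close>, even after adding a bonus
  of at most 1/16. The hypothesis on \<open>w\<close> suits anchors that were below \<open>B\<close>
  and gained at most one unit.\<close>

lemma \<phi>_le:
  assumes "w \<le> real p * (B + 1)" "r \<le> rounds"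
  shows "\<phi> r w \<le> 3 / 8"
proof -
  have "real p * 1 \<le> real p * real k" using k_pos by (intro mult_left_mono) auto
  then have "w - real p * B \<le> real p * real k" using assms(1) by (simp add: algebra_simps)
  then have "\<alpha> * (w - real p * B) \<le> 1 / 8"
    unfolding \<alpha>_p[symmetric] using \<alpha>_pos by (intro mult_left_mono) auto
  moreover have "real r / (8 * real M * fact k) \<le> real rounds / (8 * real M * fact k)"
    using assms(2) by (intro divide_right_mono) auto
  moreover have "real rounds / (8 * real M * fact k) = 1 / 4"
    using M_ge by (simp add: rounds_def)
  ultimately show ?thesis unfolding \<phi>_def by linarith
qed

lemma fact_k_le: "8 * (fact k :: real) \<le> real (p - 1)"
proof -
  have "real (8 * fact k) \<le> real (p - 1)" using p_ge by (simp only: of_nat_le_iff)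
  then show ?thesis by simp
qed

text \<open>One half of the bonus \<open>\<alpha> / fact k\<close> is the increment of
  \<open>\<phi>\<close> per round, and the other half covers \<open>\<kappa>\<close>.\<close>

lemma round_gain: "\<phi> (Suc r) w \<le> \<phi> r w - \<kappa> + \<alpha> / fact k"
proof -
  have "2 * (fact k :: real) * (B + 1) \<le> real p * (2 * real k)"
    using fact_k_le B_less B_nonneg by (intro mult_mono) auto
  then have "(B + 1) * (2 * fact k) \<le> real M" by (simp add: M_def algebra_simps)
  moreover have "x / m \<le> 1 / q" if "x * q \<le> m" "0 < m" "0 < q" for x m q :: real
    using that by (simp add: field_simps)
  ultimately have "(B + 1) / real M \<le> 1 / (2 * fact k)"
    using M_ge by simp
  then have "\<alpha> * ((B + 1) / real M) \<le> \<alpha> * (1 / (2 * fact k))"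
    using \<alpha>_pos by (intro mult_left_mono) auto
  moreover have "\<alpha> / fact k = 2 * (\<alpha> * (1 / (2 * fact k)))"
    "1 / (8 * real M * fact k) = \<alpha> * (1 / (2 * fact k))"
    by (simp_all add: \<alpha>_def)
  moreover have "real (Suc r) / (8 * real M * fact k) =
      real r / (8 * real M * fact k) + 1 / (8 * real M * fact k)"
    "\<alpha> * (B + 1) / real M = \<alpha> * ((B + 1) / real M)"
    by (simp_all add: add_divide_distrib distrib_left)
  ultimately show ?thesis unfolding \<phi>_def \<kappa>_def by argo
qed

text \<open>The \<open>2 * fact k\<close> expected promotions amount to at most a quarter of the
  \<open>p - 1\<close> anchors.\<close>

lemma survival_bound:
  assumes "r \<le> rounds"
  shows "3 / 4 \<le> 1 - real r / (real M * real (p - 1))"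
proof -
  have "real r / (real M * real (p - 1)) \<le> real rounds / (real M * real (p - 1))"
    using assms by (intro divide_right_mono) auto
  also have "\<dots> = 2 * fact k / real (p - 1)" using M_ge by (simp add: rounds_def)
  also have "\<dots> \<le> 1 / 4" using fact_k_le p_ge2 by (simp add: divide_le_eq)
  finally show ?thesis by simp
qed

section \<open>The linear lower bound for the value\<close>

lemma fresh_full:
  assumes "card A = k" "\<And>i. 0 \<le> f i"
  shows "fresh A f"
  using assms by (simp add: fresh_def)

text \<open>
  A round starts fresh, so a bound inside the round with bonus \<open>\<alpha> / fact k\<close> yields one for its
  start.
\<close>

lemma val_new_round_ge:
  assumes Q: "Q \<subseteq> cups" "card Q = p - 1" and f: "\<And>i. 0 \<le> f i"
    and IH: "\<And>r'. r = Suc r' \<Longrightarrow> min (3 / 4)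
      (\<phi> r' (sum f Q) - \<kappa> + bonus (cups - Q) f) \<le> val (k * r' + card (cups - Q)) (new_round Q) f"
  shows "min (3 / 4) (\<phi> r (sum f Q)) \<le> val (k * r) (new_round Q) f"
proof (cases r)
  case 0
  \<comment> \<open>At the end of the game either some cup reaches \<open>B\<close> and the value is
    1, or the anchors hold at most \<open>p * B\<close> and the bound is not positive.\<close>
  have "\<phi> 0 (sum f Q) \<le> 0" if "\<forall>i<n. f i < B"
  proof -
    have "sum f Q \<le> (\<Sum>i\<in>Q. B)"
      using Q n_ge that by (intro sum_mono less_imp_le) (auto simp: cups_def)
    also have "\<dots> \<le> real p * B" using Q B_nonneg by (simp add: mult_right_mono)
    finally show ?thesis using \<alpha>_pos by (simp add: \<phi>_def mult_le_0_iff)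
  qed
  then show ?thesis using 0 by (auto simp: not_le)
next
  case (Suc r')
  have "bonus (cups - Q) f = \<alpha> / fact k"
    using fresh_full[of "cups - Q" f] card_pool[OF Q] f by (simp add: bonus_def)
  then show ?thesis
    using IH[OF Suc] round_gain[of r' "sum f Q"] card_pool[OF Q] unfolding Suc
    by (simp add: add.commute min_le_iff_disj) linarith
qed

text \<open>Induction on the remaining steps. A full anchor already guarantees 3/4, which is why the
  bound is capped there. Otherwise every move of the emptier either pays \<open>\<alpha>\<close> by
  skipping an anchor or touches at most one active cup, which the filler may guess. The term
  \<open>\<kappa>\<close> is the swap loss still pending in the current round.\<close>

lemma val_ge:
  assumes "(Q, A) \<in> states" "\<And>i. 0 \<le> f i" "t = k * r + card A" "Suc r \<le> rounds"
  shows "min (3 / 4) (\<phi> r (sum f Q) - \<kappa> + bonus A f) \<le> val t (Q, A) f"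
  using assms
proof (induction t arbitrary: Q A f r)
  case 0
  then show ?case using statesD(8)[OF 0(1)] by simp
next
  case (Suc t)
  note st = statesD[OF Suc.prems(1)]
  let ?W = "sum f Q"
  show ?case
  proof (cases "\<exists>i\<in>Q. B \<le> f i")
    case True
    then obtain i where "i \<in> Q" "B \<le> f i" by blast
    then have "1 - (real r + 1) / (real M * real (p - 1)) \<le> val (Suc t) (Q, A) f"
      by (rule val_full_anchor[OF Suc.prems(1,2) _ _ Suc.prems(3)])
    then have "3 / 4 \<le> val (Suc t) (Q, A) f"
      using survival_bound[OF Suc.prems(4)] unfolding of_nat_Suc add.commute[of 1] by (rule order_trans[rotated])
    then show ?thesis by (rule min.coboundedI1)
  next
    case small: False
    show ?thesis
    proof (rule le_val_Suc)
      fix h assume h: "h \<in> moves n p (\<lambda>i. f i + place (Q, A) i)"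
      note mv = moves_bounds[OF Suc.prems(1,2) h]
      let ?W' = "sum h Q"
      have hQ: "h i \<le> B + 1" if "i \<in> Q" for i using mv(2)[OF that] small that by force
      have "?W' \<le> (\<Sum>i\<in>Q. B + 1)" by (intro sum_mono hQ)
      also have "\<dots> \<le> real p * (B + 1)" using st B_nonneg by (simp add: mult_right_mono)
      finally have W': "\<phi> r ?W' \<le> 3 / 8" using Suc.prems(4) by (intro \<phi>_le) auto
      have "?W \<le> ?W'" using mv(2) by (intro sum_mono) auto
      then have WW': "\<phi> r ?W \<le> \<phi> r ?W'" by (rule \<phi>_mono)
      have "\<phi> r ?W - \<kappa> + bonus A f \<le> measure_pmf.expectation (kernel (Q, A)) (\<lambda>s'. val t s' h)"
      proof (cases "card A = 1")
        case False
        have IH: "\<phi> r ?W' - \<kappa> + bonus (A - {x}) h \<le> val t (Q, A - {x}) h" if "x \<in> A" for x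
        proof -
          have "(Q, A - {x}) \<in> states"
            using Suc.prems(1) False that by (auto simp: states_def card_1_singleton_iff)
          moreover have "t = k * r + card (A - {x})"
            using Suc.prems(3) that st by simp
          ultimately show ?thesis
            using Suc.IH[of Q "A - {x}" h r] mv(1) Suc.prems(4) W' \<alpha>_le \<kappa>_nonneg
              bonus_bounds[of "A - {x}" h] by (simp add: min_le_iff_disj)
        qed
        let ?b = "\<phi> r ?W - \<kappa>"
        have "real (card A) * (?b + bonus A f) \<le> (\<Sum>x\<in>A. val t (Q, A - {x}) h)"
        proof (cases "?W + 1 \<le> ?W' \<or> \<not> fresh A f")
          \<comment> \<open>A skipped anchor pays \<open>\<alpha>\<close>, at least the whole bonus,
            and without freshness there is no bonus to preserve; so every choice of \<open>x\<close>
            meets the bound.\<close>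
          case True
          have "?b + bonus A f \<le> val t (Q, A - {x}) h" if "x \<in> A" for x
          proof -
            have "\<phi> r ?W + bonus A f \<le> \<phi> r ?W'"
            proof (cases "fresh A f")
              case True
              then have "\<phi> r (?W + 1) \<le> \<phi> r ?W'"
                using \<open>?W + 1 \<le> ?W' \<or> \<not> fresh A f\<close> by (intro \<phi>_mono) auto
              then show ?thesis using \<phi>_add[of r ?W 1] bonus_bounds(2)[of A f] by simp
            qed (use WW' in \<open>simp add: bonus_def\<close>)
            then show ?thesis using IH[OF that] bonus_bounds(1)[of "A - {x}" h] by linarith
          qed
          then show ?thesis by (intro sum_bounded_below)
        next
          \<comment> \<open>Only deactivating the touched cup \<open>z\<close> is credited with a
            bonus. It has probability \<open>1 / Suc a\<close>, and \<open>\<alpha> / fact a\<close>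
            divided by \<open>Suc a\<close> is the bonus required.\<close>
          case fresh: False
          then obtain z where z: "z \<in> A" "\<And>i. i \<in> A - {z} \<Longrightarrow> h i = f i + 1 / real (card A)"
            using mv(4) by blast
          define a where "a = card A - 1"
          have a: "card A = Suc a" using st(8) by (simp add: a_def)
          have "card (A - {z}) = a" using z a st by simp
          have "fresh (A - {z}) h"
            unfolding fresh_def \<open>card (A - {z}) = a\<close>
          proof
            fix i assume i: "i \<in> A - {z}"
            then have "harm k - harm (Suc a) \<le> f i" using fresh a by (simp add: fresh_def)
            then show "harm k - harm a \<le> h i"
              using z(2)[OF i] a by (simp add: harm_Suc inverse_eq_divide)
          qed
          then have "bonus (A - {z}) h = \<alpha> / fact a"
            using \<open>card (A - {z}) = a\<close> by (simp add: bonus_def)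
          then have z': "?b + \<alpha> / fact a \<le> val t (Q, A - {z}) h"
            using IH[OF z(1)] WW' by linarith
          have "?b \<le> val t (Q, A - {x}) h" if "x \<in> A - {z}" for x
            using IH[of x] that WW' bonus_bounds(1)[of "A - {x}" h] by simp
          then have "real a * ?b \<le> (\<Sum>x\<in>A - {z}. val t (Q, A - {x}) h)"
            using sum_bounded_below[of "A - {z}" ?b "\<lambda>x. val t (Q, A - {x}) h"]
              \<open>card (A - {z}) = a\<close> by simp
          moreover have "(\<Sum>x\<in>A. val t (Q, A - {x}) h) =
              val t (Q, A - {z}) h + (\<Sum>x\<in>A - {z}. val t (Q, A - {x}) h)"
            using z st by (simp add: sum.remove)
          moreover have "real (card A) * bonus A f = \<alpha> / fact a"
            using fresh a by (simp add: bonus_def del: of_nat_Suc)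
          ultimately show ?thesis using z' by (simp add: a algebra_simps)
        qed
        then show ?thesis
          using st(8) by (simp add: expectation_kernel_drop[OF Suc.prems(1) False] field_simps)
      next
        case True
        then obtain x where x: "A = {x}" by (auto simp: card_1_singleton_iff)
        have xQ: "x \<notin> Q" using st x by auto
        have t: "t = k * r" using Suc.prems(3) True by simp
        note swap = swap_anchor[of Q x]
        have new: "min (3 / 4) (\<phi> r (sum h Q')) \<le> val t (new_round Q') h"
          if Q': "Q' \<subseteq> cups" "card Q' = p - 1" for Q'
          unfolding t
        proof (rule val_new_round_ge[OF Q' mv(1)])
          fix r' assume r': "r = Suc r'"
          have "t = k * r' + card (cups - Q')" using t r' card_pool[OF Q'] by simp
          then show "min (3 / 4) (\<phi> r' (sum h Q') - \<kappa> + bonus (cups - Q') h)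
              \<le> val (k * r' + card (cups - Q')) (new_round Q') h"
            using Suc.IH[of Q' "cups - Q'" h r'] new_round_states[OF Q'] mv(1) Suc.prems(4) r'
            by (simp add: new_round_def)
        qed
        define b where "b = \<phi> r ?W'"
        have stay: "b \<le> val t (new_round Q) h"
          using new[OF st(1,2)] W' by (simp add: b_def)
        \<comment> \<open>The least change of the bound under a promotion. A full cup raises it from
          at most 3/8 to 3/4, so 1/4 is safe and gives \<open>d / M = \<alpha>\<close>; otherwise an
          anchor holding at most \<open>B + 1\<close> is exchanged for a possibly empty cup.\<close>
        define d where "d = (if fresh A f then 1 / 4 else \<alpha> * - (B + 1))"
        have promote: "b + d \<le> val t (new_round (insert x (Q - {j}))) h" if j: "j \<in> Q" for j
        proof (cases "fresh A f")
          case True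
          \<comment> \<open>With one active cup, freshness means fill at least
            \<open>harm k - 1\<close>.\<close>
          have hx: "B \<le> h x"
            using True mv(3)[OF x] B_le by (simp add: fresh_def x harm_expand)
          let ?Q' = "insert x (Q - {j})"
          have "3 / 4 \<le> val t (new_round ?Q') h"
          proof (cases r)
            case 0
            have "x < n" using st x n_ge by (auto simp: cups_def)
            then show ?thesis using hx 0 t by auto
          next
            case (Suc r')
            have "?Q' \<subseteq> cups" "card ?Q' = p - 1" using swap Suc.prems(1) x j by auto
            then have "1 - (real r' + 1) / (real M * real (p - 1)) \<le> val t (new_round ?Q') h"
              unfolding new_round_def using new_round_states[of ?Q'] mv(1) hx t Suc card_pool[of ?Q']
              by (intro val_full_anchor[of _ _ _ x]) (auto simp: new_round_def)
            moreover have "3 / 4 \<le> 1 - real r / (real M * real (p - 1))"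
              using Suc.prems(4) by (intro survival_bound) simp
            ultimately show ?thesis
              unfolding Suc of_nat_Suc add.commute[of 1] by (rule order_trans[rotated])
          qed
          then show ?thesis using True W' by (simp add: b_def d_def)
        next
          case False
          have "sum h (insert x (Q - {j})) = h x + (?W' - h j)"
            using st xQ j by (simp add: sum_diff1)
          then have "?W' + - (B + 1) \<le> sum h (insert x (Q - {j}))"
            using mv(1)[of x] hQ[OF j] by linarith
          then have "\<phi> r (?W' + - (B + 1)) \<le> \<phi> r (sum h (insert x (Q - {j})))"
            by (rule \<phi>_mono)
          then have "b + d \<le> \<phi> r (sum h (insert x (Q - {j})))"
            unfolding \<phi>_add using False by (simp only: b_def d_def if_False)
          moreover have "d \<le> 0"
            using False \<alpha>_pos B_nonneg by (simp add: d_def mult_le_0_iff)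
          moreover have "min (3 / 4) (\<phi> r (sum h (insert x (Q - {j}))))
              \<le> val t (new_round (insert x (Q - {j}))) h"
            using swap[OF _ j] Suc.prems(1) x by (intro new) auto
          ultimately show ?thesis using W' unfolding b_def by linarith
        qed
        have "real (p - 1) * (b + d) \<le> (\<Sum>j\<in>Q. val t (new_round (insert x (Q - {j}))) h)"
          using sum_bounded_below[of Q "b + d"] promote st by simp
        then have "real (p - 1) * (b + d) / (real M * real (p - 1)) \<le>
            (\<Sum>j\<in>Q. val t (new_round (insert x (Q - {j}))) h) / (real M * real (p - 1))"
          by (rule divide_right_mono) simp
        moreover have "real (p - 1) * (b + d) / (real M * real (p - 1)) = (b + d) / real M"
          using p_ge2 by simp
        moreover have "(1 - 1 / real M) * b \<le> (1 - 1 / real M) * val t (new_round Q) h"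
          using stay M_ge by (intro mult_left_mono) auto
        moreover have "(1 - 1 / real M) * b + (b + d) / real M = b + d / real M"
          by (simp add: algebra_simps add_divide_distrib)
        moreover have "- \<kappa> + bonus A f \<le> d / real M"
        proof (cases "fresh A f")
          case True
          then have "d / real M = \<alpha>" by (simp add: d_def \<alpha>_def)
          then show ?thesis using \<kappa>_nonneg bonus_bounds(2)[of A f] by linarith
        next
          case False
          then show ?thesis by (simp only: d_def \<kappa>_def bonus_def if_False mult_minus_right minus_divide_left
                add_0_right order_refl)
        qed
        moreover have "measure_pmf.expectation (kernel (Q, A)) (\<lambda>s'. val t s' h) =
            (1 - 1 / real M) * val t (new_round Q) h +
            (\<Sum>j\<in>Q. val t (new_round (insert x (Q - {j}))) h) / (real M * real (p - 1))"
          using expectation_kernel_promote[of Q x] Suc.prems(1) x by simp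
        moreover have "\<phi> r ?W \<le> b" using WW' by (simp only: b_def)
        ultimately show ?thesis by argo
      qed
      then show "min (3 / 4) (\<phi> r ?W - \<kappa> + bonus A f)
          \<le> measure_pmf.expectation (kernel (Q, A)) (\<lambda>s'. val t s' h)"
        by (simp add: min_le_iff_disj)
    qed simp
  qed
qed

text \<open>From empty cups, \<open>\<phi>\<close> starts with a deficit
  \<open>\<alpha> * p * B\<close> of at most 1/8, against 1/4 from the rounds.\<close>

lemma filler_wins:
  "\<exists>F. oblivious_filler n p F \<and>
     (\<forall>e. legal_emptier n p e \<longrightarrow>
        1 / 8 \<le> measure_pmf.prob F {x. B \<le> backlog n x e (k * rounds)})"
proof -
  define Q where "Q = {..<p - 1}"
  have Q: "Q \<subseteq> cups" "card Q = p - 1" by (auto simp: Q_def cups_def)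
  let ?F = "map_pmf placements_of (traj (k * rounds) (new_round Q))"
  have s: "new_round Q \<in> states" by (rule new_round_states[OF Q])
  have "min (3 / 4) (\<phi> rounds (sum (\<lambda>_. 0) Q)) \<le> val (k * rounds) (new_round Q) (\<lambda>_. 0)"
  proof (rule val_new_round_ge[OF Q])
    fix r' assume "rounds = Suc r'"
    then show "min (3 / 4) (\<phi> r' (sum (\<lambda>_. 0) Q) - \<kappa> + bonus (cups - Q) (\<lambda>_. 0))
        \<le> val (k * r' + card (cups - Q)) (new_round Q) (\<lambda>_. 0)"
      using s unfolding new_round_def by (intro val_ge) auto
  qed simp
  moreover have "1 / 8 \<le> \<phi> rounds 0"
  proof -
    have "\<alpha> * (real p * B) \<le> \<alpha> * (real p * real k)"
      using \<alpha>_pos B_less by (intro mult_left_mono) auto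
    moreover have "real rounds / (8 * real M * fact k) = 1 / 4"
      using M_ge by (simp add: rounds_def)
    ultimately show ?thesis
      using \<alpha>_p unfolding \<phi>_def by (simp only: diff_0 mult_minus_right)
  qed
  ultimately have val: "1 / 8 \<le> val (k * rounds) (new_round Q) (\<lambda>_. 0)" by simp
  have "1 / 8 \<le> measure_pmf.prob ?F {x. B \<le> backlog n x e (k * rounds)}"
    if e: "legal_emptier n p e" for e
  proof -
    have "n > 0" using n_ge p_ge2 by linarith
    then have "B \<le> backlog n x e (k * rounds) \<longleftrightarrow> (\<exists>i<n. B \<le> fill x e (k * rounds) i)" for x
      unfolding backlog_def by (subst Max_ge_iff) auto
    then show ?thesis
      using val val_le_prob[OF e, of "[]" "new_round Q" "k * rounds"] s by (simp add: vimage_def)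
  qed
  moreover have "oblivious_filler n p ?F"
    using set_traj[OF s] legal_placements_of by (auto simp: oblivious_filler_def)
  ultimately show ?thesis by blast
qed

end

subsection \<open>Choice of the parameters\<close>

text \<open>Each doubling adds \<open>2 ^ j\<close> terms of size at least
  \<open>1 / 2 ^ Suc j\<close>.\<close>

lemma harm_power2: "1 + real j / 2 \<le> harm (2 ^ j)"
proof (induction j)
  case (Suc j)
  have eq: "{1..2 ^ Suc j} = {1..2 ^ j} \<union> {2 ^ j + 1..(2 ^ Suc j :: nat)}" by auto
  have "1 / 2 = (\<Sum>i = 2 ^ j + 1..(2 ^ Suc j :: nat). 1 / (2 ^ Suc j :: real))" by simp
  also have "\<dots> \<le> (\<Sum>i = 2 ^ j + 1..(2 ^ Suc j :: nat). inverse (real i))"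
  proof (rule sum_mono)
    fix i :: nat assume i: "i \<in> {2 ^ j + 1..2 ^ Suc j}"
    then have "real i \<le> real (2 ^ Suc j)" by (simp only: of_nat_le_iff atLeastAtMost_iff)
    then show "1 / (2 ^ Suc j :: real) \<le> inverse (real i)"
      using i by (simp add: field_simps)
  qed
  finally have "harm (2 ^ j) + 1 / 2 \<le> (harm (2 ^ Suc j) :: real)"
    unfolding harm_def eq by (subst sum.union_disjoint) auto
  with Suc show ?case by (simp add: add_divide_distrib)
qed (simp add: harm_def)

text \<open>From \<open>k \<le> 2 ^ (k - 1)\<close> one gets
  \<open>fact k \<le> k ^ k \<le> 2 ^ ((k - 1) * k)\<close> for positive \<open>k\<close>. The spare
  factor \<open>2 ^ k\<close> later bounds \<open>k\<close> by the logarithm of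
  \<open>p\<close>.\<close>

lemma fact_times_2_power: "fact k * 2 ^ k \<le> (2 :: nat) ^ k\<^sup>2"
proof (cases k)
  case (Suc m)
  have "k \<le> 2 ^ m" using less_exp[of m] Suc by (simp add: Suc_le_eq)
  then have "k ^ k \<le> (2 ^ m) ^ k" by (rule power_mono) simp
  then have "fact k \<le> (2 :: nat) ^ (m * k)"
    using fact_le_power[of k, where 'a = nat] by (simp add: power_mult)
  then have "fact k * 2 ^ k \<le> (2 :: nat) ^ (m * k) * 2 ^ k" by simp
  also have "\<dots> = 2 ^ k\<^sup>2" by (simp add: Suc power2_eq_square power_add)
  finally show ?thesis .
qed simp

text \<open>The largest admissible \<open>j\<close> is taken; its maximality bounds the iterated
  logarithm from above, and the threshold \<open>2 ^ 16\<close> makes \<open>j = 2\<close>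
  admissible.\<close>

lemma ex_round_length:
  fixes p :: nat
  assumes "2 ^ 16 \<le> p"
  obtains j k :: nat where "k = 2 ^ j" "2 \<le> j" "2 ^ k\<^sup>2 \<le> p"
    "log 2 (log 2 (real p)) \<le> 2 * real j + 2"
proof -
  let ?P = "\<lambda>j. 2 ^ (2 ^ j)\<^sup>2 \<le> p"
  have bound: "j \<le> p" if "?P j" for j
  proof -
    have "j \<le> 2 ^ j" "(2::nat) ^ j \<le> (2 ^ j)\<^sup>2" "((2::nat) ^ j)\<^sup>2 \<le> 2 ^ (2 ^ j)\<^sup>2"
      by (auto simp: less_imp_le[OF less_exp] power2_nat_le_imp_le power2_eq_square)
    with that show ?thesis by linarith
  qed
  have P2: "?P 2" using assms by simp
  define j where "j = (GREATEST j. ?P j)"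
  have j: "?P j" unfolding j_def using P2 bound by (rule GreatestI_nat)
  have "2 \<le> j" unfolding j_def using P2 bound by (rule Greatest_le_nat)
  have "\<not> ?P (Suc j)"
  proof
    assume "?P (Suc j)"
    then have "Suc j \<le> j" unfolding j_def using bound by (rule Greatest_le_nat)
    then show False by simp
  qed
  then have "p < 2 ^ (2 ^ (2 * Suc j))" by (simp add: power_mult power2_eq_square flip: power_mult_distrib power_add)
  then have "real p < 2 ^ (2 ^ (2 * Suc j))" by (metis of_nat_less_iff of_nat_numeral of_nat_power)
  then have "log 2 (real p) < log 2 (2 ^ (2 ^ (2 * Suc j)))"
    using assms by (subst log_less_cancel_iff) auto
  then have "log 2 (real p) < 2 ^ (2 * Suc j)" by (simp only: log_pow_cancel) simp
  moreover have "0 < log 2 (real p)" using assms by simp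
  ultimately have "log 2 (log 2 (real p)) < log 2 (2 ^ (2 * Suc j))"
    by (subst log_less_cancel_iff) auto
  then have "log 2 (log 2 (real p)) < real (2 * Suc j)" by (simp only: log_pow_cancel)
  then show ?thesis using that[of "2 ^ j" j] \<open>2 \<le> j\<close> j by simp
qed

text \<open>This serves small \<open>p\<close>. For \<open>p \<ge> 2\<close>, spreading
  \<open>p\<close> units evenly over \<open>p + 1\<close> cups leaves an unselected one with fill
  \<open>p / (p + 1)\<close>; for \<open>p = 1\<close> the target is 0.\<close>

lemma filler_wins_one_step:
  fixes p n :: nat
  assumes "1 \<le> p" "2 \<le> p \<longrightarrow> p + 1 \<le> n" "p \<le> n"
  obtains F where "oblivious_filler n p F"
    "\<And>e. legal_emptier n p e \<Longrightarrow>
       measure_pmf.prob F {x. (if p = 1 then 0 else 1 / 2) \<le> backlog n x e 1} = 1"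
proof -
  define x :: placements where
    "x t i = (if 2 \<le> p \<and> i < p + 1 then real p / real (p + 1) else 0)" for t i
  have sum: "(\<Sum>i<n. x t i) \<le> real p" for t
  proof (cases "2 \<le> p")
    case True
    have "(\<Sum>i<n. x t i) = (\<Sum>i<p + 1. x t i)"
      using assms(2) True by (intro sum.mono_neutral_right) (auto simp: x_def)
    also have "\<dots> = (\<Sum>i<p + 1. real p / real (p + 1))"
      using True by (intro sum.cong) (auto simp: x_def)
    finally show ?thesis by simp
  qed (simp add: x_def)
  have legal: "legal_placements n p x"
    using sum assms(2) by (auto simp: legal_placements_def x_def)
  show thesis
  proof (rule that)
    show "oblivious_filler n p (return_pmf x)" using legal by (simp add: oblivious_filler_def)
    fix e assume e: "legal_emptier n p e"
    obtain S where S: "S \<subseteq> {..<n}" "card S = p" "\<And>i. i \<in> S \<Longrightarrow> 0 \<le> fill x e 1 i"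
      "\<And>i. i \<notin> S \<Longrightarrow> fill x e 1 i = x 0 i"
      using fill_Suc_in_moves[OF e legal, of 0] by (auto simp: moves_def simp del: fill.simps(2))
    have "\<exists>i<n. (if p = 1 then 0 else 1 / 2) \<le> fill x e 1 i"
    proof (cases "p = 1")
      case True
      then obtain i where "S = {i}" using S(2) by (auto simp: card_1_singleton_iff)
      then show ?thesis using S(1) S(3)[of i] True by auto
    next
      case False
      have "\<not> {..<p + 1} \<subseteq> S"
        using card_mono[of S "{..<p + 1}"] S(1,2) finite_subset[OF S(1)] by auto
      then obtain i where i: "i < p + 1" "i \<notin> S" by blast
      then have "1 / 2 \<le> fill x e 1 i" using S(4)[of i] assms(1) False by (simp add: x_def field_simps)
      then show ?thesis using i assms(1,2) False by (intro exI[of _ i]) auto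
    qed
    then have "(if p = 1 then 0 else 1 / 2) \<le> backlog n x e 1"
      unfolding backlog_def using assms by (subst Max_ge_iff) auto
    then show "measure_pmf.prob (return_pmf x)
        {x. (if p = 1 then 0 else 1 / 2) \<le> backlog n x e 1} = 1"
      by (simp add: indicator_def)
  qed
qed

theorem theorem5p7:
  "\<exists>c > (0::real). \<exists>\<delta> > (0::real). \<exists>\<epsilon> > (0::real). \<exists>P :: nat poly.
     \<forall>p n :: nat. 1 \<le> p \<longrightarrow> real p + c * log 2 (real p) \<le> real n \<longrightarrow>
       (\<exists>F s. oblivious_filler n p F \<and> 1 \<le> s \<and> s \<le> poly P p \<and>
          (\<forall>E. randomized_emptier n p E \<longrightarrow>
             \<delta> \<le> \<P>((x, e) in joint_law F E.
                    \<epsilon> * log 2 (log 2 (real p)) \<le> backlog n x e s)))"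
proof -
  \<comment> \<open>The step number is \<open>4 * k * k * fact k * p\<close>, where \<open>k\<close>
    and \<open>fact k\<close> are at most \<open>p\<close>.\<close>
  let ?P = "monom 4 4 :: nat poly"
  have main: "\<exists>F s. oblivious_filler n p F \<and> 1 \<le> s \<and> s \<le> poly ?P p \<and>
      (\<forall>e. legal_emptier n p e \<longrightarrow>
         1 / 8 \<le> measure_pmf.prob F {x. 1 / 8 * log 2 (log 2 (real p)) \<le> backlog n x e s})"
    if p: "1 \<le> p" and n: "real p + log 2 (real p) \<le> real n" for p n :: nat
  proof (cases "2 ^ 16 \<le> p")
    case False
    have "0 \<le> log 2 (real p)" using p by simp
    then have "real p \<le> real n" using n by linarith
    then have pn: "p \<le> n" by simp
    have "p + 1 \<le> n" if "2 \<le> p"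
    proof -
      have "1 \<le> log 2 (real p)" using that by (subst le_log_iff) auto
      then have "real (p + 1) \<le> real n" using n by simp
      then show ?thesis by (simp only: of_nat_le_iff)
    qed
    then obtain F where F: "oblivious_filler n p F"
      "\<And>e. legal_emptier n p e \<Longrightarrow>
         measure_pmf.prob F {x. (if p = 1 then 0 else 1 / 2) \<le> backlog n x e 1} = 1"
      using filler_wins_one_step[OF p _ pn] by blast
    \<comment> \<open>For \<open>p = 1\<close> the inner logarithm is 0 and the outer one takes the
      default value 0; for other \<open>p\<close> below \<open>2 ^ 16\<close> the iterated logarithm
      is at most 4.\<close>
    have le: "1 / 8 * log 2 (log 2 (real p)) \<le> (if p = 1 then 0 else 1 / 2)"
    proof (cases "p = 1")
      case False
      then have "0 < log 2 (real p)" using p by simp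
      moreover have "log 2 (real p) \<le> 2 powr 4"
      proof -
        have "real p < 2 powr 16" using \<open>\<not> 2 ^ 16 \<le> p\<close> by simp
        then have "log 2 (real p) < 16" using p by (simp add: log_less_iff)
        then show ?thesis by simp
      qed
      ultimately have "log 2 (log 2 (real p)) \<le> 4" by (subst log_le_iff) auto
      then show ?thesis using False by simp
    qed (simp add: log_def)
    have "1 / 8 \<le> measure_pmf.prob F {x. 1 / 8 * log 2 (log 2 (real p)) \<le> backlog n x e 1}"
      if "legal_emptier n p e" for e
    proof -
      have "measure_pmf.prob F {x. (if p = 1 then 0 else 1 / 2) \<le> backlog n x e 1} \<le>
          measure_pmf.prob F {x. 1 / 8 * log 2 (log 2 (real p)) \<le> backlog n x e 1}"
        using le by (intro measure_pmf.finite_measure_mono) (auto intro: order_trans)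
      then show ?thesis using F(2)[OF that] by linarith
    qed
    then show ?thesis using F(1) p by (intro exI[of _ F] exI[of _ 1]) (auto simp: poly_monom)
  next
    case True
    from ex_round_length[OF True] obtain j k :: nat where k: "k = 2 ^ j" "2 \<le> j" "2 ^ k\<^sup>2 \<le> p"
      and log: "log 2 (log 2 (real p)) \<le> 2 * real j + 2" by blast
    have "(2::nat) ^ 2 \<le> k" unfolding k(1) using k(2) by (intro power_increasing) auto
    then have k4: "4 \<le> k" by simp
    have fact: "fact k * 2 ^ k \<le> p" using fact_times_2_power k(3) by (rule order_trans)
    have "(2::nat) ^ 4 \<le> 2 ^ k" using k4 by (intro power_increasing) auto
    then have "fact k * 16 \<le> fact k * (2::nat) ^ k" by (intro mult_left_mono) auto
    then have fact16: "fact k * 16 \<le> p" using fact by linarith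
    \<comment> \<open>This gives \<open>k \<le> log 2 p\<close>, so that \<open>c = 1\<close> leaves
      enough cups for a round.\<close>
    have "1 * 2 ^ k \<le> fact k * (2 :: nat) ^ k" by (intro mult_right_mono) (auto simp: fact_ge_1)
    then have kp: "2 ^ k \<le> p" using fact by linarith
    have "real (2 ^ k) \<le> real p" using kp by (simp only: of_nat_le_iff)
    then have "2 powr real k \<le> real p" by (simp add: powr_realpow)
    then have "real k \<le> log 2 (real p)" using p by (subst le_log_iff) auto
    then have "real (p + k) \<le> real n" using n by simp
    then have "p + k \<le> n" by (simp only: of_nat_le_iff)
    interpret anchored_rounds n p k "real j / 2"
    proof
      show "real j / 2 \<le> harm k - 1" using harm_power2[of j] k(1) by simp
      show "8 * fact k \<le> p - 1" using fact16 fact_ge_1[of k, where 'a = nat] by linarith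
    qed (use \<open>p + k \<le> n\<close> k4 in auto)
    obtain F where F: "oblivious_filler n p F"
      "\<And>e. legal_emptier n p e \<Longrightarrow>
         1 / 8 \<le> measure_pmf.prob F {x. real j / 2 \<le> backlog n x e (k * rounds)}"
      using filler_wins by blast
    \<comment> \<open>Here \<open>(2 * j + 2) / 8 \<le> j / 2\<close> because \<open>j\<close> is
      positive.\<close>
    have "1 / 8 * log 2 (log 2 (real p)) \<le> real j / 2" using log k(2) by simp
    then have "1 / 8 \<le>
        measure_pmf.prob F {x. 1 / 8 * log 2 (log 2 (real p)) \<le> backlog n x e (k * rounds)}"
      if "legal_emptier n p e" for e
      by (intro order_trans[OF F(2)[OF that]] measure_pmf.finite_measure_mono) auto
    moreover have "k * rounds \<le> poly ?P p"
    proof -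
      have "k \<le> p" using kp less_exp[of k] by linarith
      moreover have "fact k \<le> p" using fact16 by linarith
      ultimately have "4 * (k * k * fact k * p) \<le> 4 * (p * p * p * p)"
        by (intro mult_le_mono order.refl)
      then show ?thesis by (simp add: rounds_def M_def poly_monom power4_eq_xxxx mult_ac)
    qed
    moreover have "1 \<le> k * rounds" using k4 M_ge by (simp add: rounds_def Suc_le_eq)
    ultimately show ?thesis using F(1) by blast
  qed
  have "\<forall>p n :: nat. 1 \<le> p \<longrightarrow> real p + 1 * log 2 (real p) \<le> real n \<longrightarrow>
      (\<exists>F s. oblivious_filler n p F \<and> 1 \<le> s \<and> s \<le> poly ?P p \<and>
         (\<forall>E. randomized_emptier n p E \<longrightarrow>
            1 / 8 \<le> \<P>((x, e) in joint_law F E.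
              1 / 8 * log 2 (log 2 (real p)) \<le> backlog n x e s)))"
  proof (intro allI impI)
    fix p n :: nat assume "1 \<le> p" "real p + 1 * log 2 (real p) \<le> real n"
    then have "real p + log 2 (real p) \<le> real n" by simp
    from main[OF \<open>1 \<le> p\<close> this] obtain F s where
      F: "oblivious_filler n p F" "1 \<le> s" "s \<le> poly ?P p" and
      win: "\<And>e. legal_emptier n p e \<Longrightarrow>
         1 / 8 \<le> measure_pmf.prob F {x. 1 / 8 * log 2 (log 2 (real p)) \<le> backlog n x e s}"
      by blast
    show "\<exists>F s. oblivious_filler n p F \<and> 1 \<le> s \<and> s \<le> poly ?P p \<and>
        (\<forall>E. randomized_emptier n p E \<longrightarrow>
           1 / 8 \<le> \<P>((x, e) in joint_law F E.
             1 / 8 * log 2 (log 2 (real p)) \<le> backlog n x e s))"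
      by (intro exI[of _ F] exI[of _ s] conjI allI impI F joint_law_prob_ge win)
  qed
  moreover have "0 < (1::real)" "0 < (1 / 8 :: real)" by simp_all
  ultimately show ?thesis by blast
qed

end
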